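(* Let $\epsilon$ be the unique positive real root of the equation $\epsilon = \frac{1}{4}\left(1-\sqrt{\epsilon}\right)^3$ (so $\epsilon \approx 0.087$). Let $\mathscr{G}$ be a finite, simple, undirected, connected, regular graph on $n$ vertices with edge set $\mathscr{E}$. Let $3\mathscr{E}$ denote the set of unordered pairs $\{v_1,v_2\}$ of distinct vertices of $\mathscr{G}$ that are joined by a path in $\mathscr{G}$ of length at most $3$. Then $$|3\mathscr{E}| \geq \min\left\{ \binom{n}{2},\ (1+\epsilon)|\mathscr{E}| \right\}.$$ In particular, there is a universal constant $\epsilon>0$ with this property for all connected regular graphs.
   Context: Graphs are undirected and loopless. A graph is regular if all its vertices have the same degree. For a positive integer $h$, the $h$-fold sumgraph $h\mathscr{G}$ of $\mathscr{G}$ is the graph on the same vertex set in which two distinct vertices are adjacent iff they are joined by a path of length at most $h$ in $\mathscr{G}$; its edge set is denoted $h\mathscr{E}$. *)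

theory Defs
  imports Complex_Main
begin

definition simple_graph :: "'a set \<Rightarrow> 'a set set \<Rightarrow> bool" where
  "simple_graph V E \<longleftrightarrow> (\<forall>e\<in>E. e \<subseteq> V \<and> card e = 2)"

definition degree :: "'a set set \<Rightarrow> 'a \<Rightarrow> nat" where
  "degree E v = card {e \<in> E. v \<in> e}"

definition regular_graph :: "'a set \<Rightarrow> 'a set set \<Rightarrow> bool" where
  "regular_graph V E \<longleftrightarrow> (\<exists>d. \<forall>v\<in>V. degree E v = d)"

text \<open>A path is given by its list of vertices, so its length (number of edges) is
  \<^term>\<open>length p - 1\<close>.\<close>

definition joined_by_path ::
  "'a set \<Rightarrow> 'a set set \<Rightarrow> 'a \<Rightarrow> 'a list \<Rightarrow> 'a \<Rightarrow> bool" where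
  "joined_by_path V E u p v \<longleftrightarrow>
     p \<noteq> [] \<and> hd p = u \<and> last p = v \<and> set p \<subseteq> V \<and> distinct p \<and>
     successively (\<lambda>x y. {x, y} \<in> E) p"

definition connected_graph :: "'a set \<Rightarrow> 'a set set \<Rightarrow> bool" where
  "connected_graph V E \<longleftrightarrow> (\<forall>u\<in>V. \<forall>v\<in>V. \<exists>p. joined_by_path V E u p v)"

definition sumgraph_edges :: "nat \<Rightarrow> 'a set \<Rightarrow> 'a set set \<Rightarrow> 'a set set" where
  "sumgraph_edges h V E =
     {{u, v} | u v. u \<in> V \<and> v \<in> V \<and> u \<noteq> v \<and>
        (\<exists>p. joined_by_path V E u p v \<and> length p - 1 \<le> h)}"

definition is_eps_root :: "real \<Rightarrow> bool" where
  "is_eps_root x \<longleftrightarrow> 0 < x \<and> x = 1 / 4 * (1 - sqrt x) ^ 3"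

definition eps :: real where
  "eps = (THE x. is_eps_root x)"

end

theory Submission
  imports Defs
begin

text \<open>Let the graph be \<open>d\<close>-regular and \<open>0 \<le> \<delta> \<le> 1/4\<close>; write \<open>N\<close> for closed neighbourhoods and
  \<open>B\<^sub>2\<close>, \<open>B\<^sub>3\<close> for balls of radius 2 and 3. Call \<open>v\<close> poor if it has fewer than \<open>(1 + \<delta>) d\<close> neighbours in
  the cube of the graph. If \<open>B\<^sub>3 v = B\<^sub>2 v\<close> for a poor \<open>v\<close>, then \<open>B\<^sub>2 v\<close> is everything by connectedness,
  so any two closed neighbourhoods meet and the cube is complete. Otherwise some \<open>u\<close> outside \<open>B\<^sub>2 v\<close> is
  adjacent to some \<open>w\<close> in \<open>B\<^sub>2 v\<close>. As \<open>N u\<close> misses \<open>N v\<close>, it lies mostly outside \<open>B\<^sub>3 v\<close>, hence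
  is almost disjoint from \<open>N w\<close>, which lies inside. So every \<open>x\<close> in \<open>N w\<close> is rich: its ball of
  radius 3 contains \<open>N u \<union> N w\<close>, which has about \<open>2 d\<close> elements. Moreover \<open>N w\<close> fills
  most of \<open>N v\<close>, so poor vertices have mostly rich neighbours; double counting shows
  that there are at least \<open>1 - \<delta>\<close> times as many rich vertices as poor ones, and the surplus of the former
  pays for the deficit of the latter.\<close>

section \<open>The constant\<close>

text \<open>The left side of the equation strictly increases. The right side decreases as long as
  \<open>1 - sqrt x\<close> is nonnegative, which positivity of the odd power guarantees at a
  root.\<close>

lemma is_eps_root_unique:
  assumes "is_eps_root x" "is_eps_root y"
  shows "x = y"
proof -
  have False if "is_eps_root x" "is_eps_root y" "x < y" for x y
  proof -
    have y: "0 < y" "y = 1 / 4 * (1 - sqrt y) ^ 3" and x: "x = 1 / 4 * (1 - sqrt x) ^ 3"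
      using that by (auto simp: is_eps_root_def)
    have "0 < (1 - sqrt y) ^ 3" using y by linarith
    hence "0 \<le> 1 - sqrt y" by (simp add: zero_less_power_eq)
    moreover have "1 - sqrt y \<le> 1 - sqrt x" using that by simp
    ultimately have "(1 - sqrt y) ^ 3 \<le> (1 - sqrt x) ^ 3" by (intro power_mono)
    thus False using x y that by linarith
  qed
  thus ?thesis using assms by (meson linorder_neqE_linordered_idom)
qed

lemma is_eps_root_exists: "\<exists>x. is_eps_root x \<and> 0.0865 < x \<and> x < 0.0875"
proof -
  \<comment> \<open>The substitution \<open>x = s ^ 2\<close> makes the equation polynomial. The
    endpoints 0.2945 and 0.2958 below are chosen so that their squares lie between 0.0865 and
    0.0875.\<close>
  let ?f = "\<lambda>s::real. 4 * s ^ 2 - (1 - s) ^ 3"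
  have "\<exists>s\<ge>0.2945. s \<le> 0.2958 \<and> ?f s = 0"
    by (rule IVT') (auto simp: power2_eq_square power3_eq_cube intro!: continuous_intros)
  then obtain s where s: "0.2945 \<le> s" "s \<le> 0.2958" "?f s = 0" by blast
  have "0.2945 * 0.2945 \<le> s * s" "s * s \<le> 0.2958 * 0.2958"
    using s by (intro mult_mono; simp)+
  hence "0.0865 < s ^ 2" "s ^ 2 < 0.0875" by (simp_all add: power2_eq_square)
  moreover have "is_eps_root (s ^ 2)" using s by (simp add: is_eps_root_def)
  ultimately show ?thesis by blast
qed

lemma eps_props: "is_eps_root eps" "0.0865 < eps" "eps < 0.0875"
proof -
  obtain x where x: "is_eps_root x" "0.0865 < x" "x < 0.0875" using is_eps_root_exists by blast
  have "eps = x" unfolding eps_def using x(1) is_eps_root_unique by blast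
  thus "is_eps_root eps" "0.0865 < eps" "eps < 0.0875" using x by auto
qed

section \<open>Growth of balls for reflexive symmetric relations\<close>

text \<open>The graph enters only through its closed neighbourhoods \<open>N x\<close>.\<close>

locale regular_nbhds =
  fixes V :: "'a set" and N :: "'a \<Rightarrow> 'a set" and d :: nat
  assumes fin: "finite V"
    and N_sub: "x \<in> V \<Longrightarrow> N x \<subseteq> V"
    and N_refl: "x \<in> V \<Longrightarrow> x \<in> N x"
    and N_sym: "x \<in> V \<Longrightarrow> y \<in> N x \<Longrightarrow> x \<in> N y"
    and N_card: "x \<in> V \<Longrightarrow> card (N x) = d + 1"
    and conn: "S \<subseteq> V \<Longrightarrow> S \<noteq> {} \<Longrightarrow> (\<And>x. x \<in> S \<Longrightarrow> N x \<subseteq> S) \<Longrightarrow> S = V"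
begin

section \<open>Balls of radius two and three\<close>

definition B2 :: "'a \<Rightarrow> 'a set" where "B2 v = (\<Union>x\<in>N v. N x)"
definition B3 :: "'a \<Rightarrow> 'a set" where "B3 v = (\<Union>x\<in>B2 v. N x)"

lemma B2_sub: "v \<in> V \<Longrightarrow> B2 v \<subseteq> V"
  unfolding B2_def using N_sub by blast

lemma B3_sub: "v \<in> V \<Longrightarrow> B3 v \<subseteq> V"
  unfolding B3_def using N_sub B2_sub by blast

lemma N_sub_B2: "v \<in> V \<Longrightarrow> N v \<subseteq> B2 v"
  unfolding B2_def using N_refl by blast

lemma B2_sub_B3: "v \<in> V \<Longrightarrow> B2 v \<subseteq> B3 v"
  unfolding B3_def using N_refl B2_sub by blast

lemma N_sub_B3: "w \<in> B2 v \<Longrightarrow> N w \<subseteq> B3 v"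
  unfolding B3_def by blast

lemma finite_B3: "v \<in> V \<Longrightarrow> finite (B3 v)"
  using B3_sub fin finite_subset by blast

lemma finite_N: "v \<in> V \<Longrightarrow> finite (N v)"
  using N_sub fin finite_subset by blast

lemma B3_card_ge: "v \<in> V \<Longrightarrow> d + 1 \<le> card (B3 v)"
  using N_card[of v] card_mono[OF finite_B3, of v "N v"] N_sub_B2 B2_sub_B3 by auto

lemma N_Int_nonempty_B3:
  assumes "x \<in> V" "y \<in> V" "N x \<inter> N y \<noteq> {}"
  shows "y \<in> B3 x"
proof -
  obtain z where "z \<in> N x" "z \<in> N y" using assms by blast
  hence "y \<in> B2 x" using assms N_sym unfolding B2_def by blast
  thus ?thesis using assms B2_sub_B3 by blast
qed

lemma poor_vertex_dichotomy:
  fixes \<delta> :: real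
  assumes v: "v \<in> V" and "0 \<le> \<delta>" "\<delta> \<le> 1" and poor: "real (card (B3 v)) - 1 < (1 + \<delta>) * d"
  shows "(\<forall>x\<in>V. B3 x = V) \<or>
    (\<exists>w\<in>V. (\<forall>x\<in>N w. (2 - \<delta>) * d \<le> real (card (B3 x)) - 1) \<and>
       (1 - \<delta>) * (d + 1) \<le> real (card (N v \<inter> N w)))"
proof (cases "B3 v \<subseteq> B2 v")
  case True
  have "B2 v = V"
    using True N_sub_B3 B2_sub[OF v] N_refl[OF v] N_sub_B2[OF v] by (intro conn) blast+
  hence "B3 v = V" using B2_sub_B3[OF v] B3_sub[OF v] by blast
  hence n: "real (card V) < (1 + \<delta>) * d + 1" using poor by simp
  also have "\<dots> \<le> (1 + 1) * real d + 1"
    \<comment> \<open>The aim is fewer than \<open>2 * d + 2\<close> vertices, too few for two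
      disjoint closed neighbourhoods.\<close>
    using \<open>\<delta> \<le> 1\<close> by (intro add_mono mult_right_mono) auto
  finally have "real (card V) < real (2 * d + 1)" by simp
  hence n: "card V < 2 * d + 1" by (simp only: of_nat_less_iff)
  have "y \<in> B3 x" if "x \<in> V" "y \<in> V" for x y
  proof (rule N_Int_nonempty_B3[OF that], rule notI)
    assume "N x \<inter> N y = {}"
    hence "card (N x \<union> N y) = 2 * (d + 1)"
      using that by (simp add: card_Un_disjoint finite_N N_card)
    moreover have "card (N x \<union> N y) \<le> card V"
      using that N_sub fin by (intro card_mono) auto
    ultimately show False using n by simp
  qed
  thus ?thesis using B3_sub by blast
next
  case False
  then obtain u w where w: "w \<in> B2 v" "u \<in> N w" "u \<notin> B2 v" unfolding B3_def by blast
  have wV: "w \<in> V" using w B2_sub[OF v] by blast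
  have uV: "u \<in> V" using w wV N_sub by blast
  have "N u \<inter> N v = {}"
  proof (rule ccontr)
    assume "N u \<inter> N v \<noteq> {}"
    then obtain z where "z \<in> N u" "z \<in> N v" by blast
    hence "u \<in> B2 v" using N_sym[OF uV] unfolding B2_def by blast
    thus False using w by blast
  qed
  \<comment> \<open>Since \<open>N v\<close> already takes \<open>d + 1\<close> elements of
    \<open>B3 v\<close>, poorness leaves fewer than \<open>\<delta> * d\<close> for
    \<open>N u\<close>.\<close>
  hence "card (N u \<inter> B3 v) + card (N v) = card ((N u \<inter> B3 v) \<union> N v)"
    using uV v by (subst card_Un_disjoint) (auto simp: finite_N)
  also have "\<dots> \<le> card (B3 v)"
    using v N_sub_B2 B2_sub_B3 by (intro card_mono) (auto simp: finite_B3)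
  finally have 1: "card (N u \<inter> B3 v) + (d + 1) \<le> card (B3 v)" using v N_card by simp
  have 2: "card (N u \<inter> B3 v) + card (N u - B3 v) = d + 1"
    using card_Int_Diff[OF finite_N[OF uV], of "B3 v"] N_card[OF uV] by simp
  have rich: "(2 - \<delta>) * d \<le> real (card (B3 x)) - 1" if x: "x \<in> N w" for x
  proof -
    have xV: "x \<in> V" using x wV N_sub by blast
    have "w \<in> N x" using N_sym[OF wV x] .
    \<comment> \<open>\<open>w\<close> is one step from \<open>x\<close> and \<open>u\<close> at
      most two, so both closed neighbourhoods fit into \<open>B3 x\<close>. Removing
      \<open>B3 v\<close> from \<open>N u\<close> makes the union disjoint.\<close>
    hence "w \<in> B2 x" "u \<in> B2 x" using w N_sub_B2[OF xV] unfolding B2_def by blast+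
    hence "(N u - B3 v) \<union> N w \<subseteq> B3 x" using N_sub_B3 by blast
    hence "card ((N u - B3 v) \<union> N w) \<le> card (B3 x)" using xV by (intro card_mono finite_B3)
    moreover have "card ((N u - B3 v) \<union> N w) = card (N u - B3 v) + card (N w)"
      using uV wV N_sub_B3[OF w(1)] by (intro card_Un_disjoint) (auto simp: finite_N)
    ultimately have "card (N u - B3 v) + (d + 1) \<le> card (B3 x)" using N_card[OF wV] by simp
    thus ?thesis using 1 2 poor by (simp add: algebra_simps)
  qed
  \<comment> \<open>Two sets of size \<open>d + 1\<close> inside the small set \<open>B3 v\<close>
    must overlap heavily, by inclusion-exclusion.\<close>
  have "card (N v \<union> N w) \<le> card (B3 v)"
    using v N_sub_B2 B2_sub_B3 N_sub_B3[OF w(1)] by (intro card_mono) (auto simp: finite_B3)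
  moreover have "card (N v \<union> N w) + card (N v \<inter> N w) = 2 * (d + 1)"
    using card_Un_Int[OF finite_N[OF v] finite_N[OF wV]] N_card v wV by simp
  ultimately have "real (2 * (d + 1)) \<le> real (card (B3 v)) + real (card (N v \<inter> N w))" by linarith
  moreover have "(1 - \<delta>) * (real d + 1) \<le> (1 - \<delta>) * d + 1"
    using \<open>0 \<le> \<delta>\<close> by (simp add: algebra_simps)
  ultimately have "(1 - \<delta>) * (d + 1) \<le> real (card (N v \<inter> N w))"
    using poor by (simp add: algebra_simps)
  thus ?thesis using rich wV by blast
qed

text \<open>Both sides count the pairs in \<open>P \<times> R\<close> related by the symmetric
  relation \<open>N\<close>.\<close>

lemma sum_card_N_swap:
  assumes "P \<subseteq> V" "R \<subseteq> V"
  shows "(\<Sum>v\<in>P. card (N v \<inter> R)) = (\<Sum>x\<in>R. card (N x \<inter> P))"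
proof -
  have fin': "finite P" "finite R" using assms fin finite_subset by blast+
  have *: "card (N v \<inter> S) = (\<Sum>x\<in>S. if x \<in> N v then 1 else 0)" if "finite S" for v S
    using that by (simp add: sum.If_cases Int_commute)
  have "(\<Sum>v\<in>P. card (N v \<inter> R)) = (\<Sum>x\<in>R. \<Sum>v\<in>P. if x \<in> N v then 1 else 0)"
    using fin' by (simp only: * sum.swap[of _ R P])
  also have "\<dots> = (\<Sum>x\<in>R. \<Sum>v\<in>P. if v \<in> N x then 1 else 0)"
    using assms N_sym by (intro sum.cong refl) (metis subsetD)
  finally show ?thesis using fin' by (simp only: *)
qed

text \<open>Against the target \<open>(1 + \<delta>) * d\<close>, a vertex of \<open>R\<close> has
  surplus at least \<open>(1 - 2 * \<delta>) * d\<close>, and one of \<open>P\<close> has deficit at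
  most \<open>\<delta> * d\<close>, because \<open>B3 v\<close> contains \<open>N v\<close>.\<close>

lemma sum_card_B3_ge:
  fixes \<delta> :: real
  assumes "0 \<le> \<delta>" "\<delta> \<le> 1 / 4" and not_complete: "\<not> (\<forall>x\<in>V. B3 x = V)"
  shows "(1 + \<delta>) * d * card V \<le> (\<Sum>v\<in>V. real (card (B3 v)) - 1)"
proof -
  define P where "P = {v \<in> V. real (card (B3 v)) - 1 < (1 + \<delta>) * d}"
  define R where "R = {v \<in> V. (2 - \<delta>) * d \<le> real (card (B3 v)) - 1}"
  have PR: "P \<subseteq> V" "R \<subseteq> V" "finite P" "finite R" using fin by (auto simp: P_def R_def)
  have "(1 + \<delta>) * d \<le> (2 - \<delta>) * d" using assms by (intro mult_right_mono) auto
  hence disj: "P \<inter> R = {}" by (auto simp: P_def R_def)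
  have "(1 - \<delta>) * (d + 1) \<le> real (card (N v \<inter> R))" if "v \<in> P" for v
  proof -
    have v: "v \<in> V" "real (card (B3 v)) - 1 < (1 + \<delta>) * d" using that by (auto simp: P_def)
    then obtain w where w: "w \<in> V" "\<forall>x\<in>N w. (2 - \<delta>) * d \<le> real (card (B3 x)) - 1"
        "(1 - \<delta>) * (d + 1) \<le> real (card (N v \<inter> N w))"
      using poor_vertex_dichotomy[of v \<delta>] assms by auto
    have "N w \<subseteq> R" using w N_sub unfolding R_def by blast
    hence "card (N v \<inter> N w) \<le> card (N v \<inter> R)" using PR by (intro card_mono) auto
    thus ?thesis using w by linarith
  qed
  hence "(\<Sum>v\<in>P. (1 - \<delta>) * (d + 1)) \<le> (\<Sum>v\<in>P. real (card (N v \<inter> R)))"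
    by (intro sum_mono)
  also have "\<dots> = (\<Sum>x\<in>R. real (card (N x \<inter> P)))"
    using sum_card_N_swap[OF PR(1,2)] by (metis of_nat_sum)
  also have "\<dots> \<le> (\<Sum>x\<in>R. real (d + 1))"
  proof (intro sum_mono)
    fix x assume "x \<in> R"
    hence "x \<in> V" using PR by blast
    thus "real (card (N x \<inter> P)) \<le> real (d + 1)"
      using card_mono[OF finite_N, of x "N x \<inter> P"] N_card[of x] by simp
  qed
  finally have "((1 - \<delta>) * card P) * (real d + 1) \<le> card R * (real d + 1)"
    by (simp add: algebra_simps)
  hence count: "(1 - \<delta>) * card P \<le> card R" by (rule mult_right_le_imp_le) simp
  \<comment> \<open>This is where the bound 1/4 on \<delta> enters: it makes the surplus of
    \<open>(1 - \<delta>) * card P\<close> rich vertices cover the deficit of all poor ones.\<close>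
  have "\<delta> * card P \<le> (1 - 2 * \<delta>) * ((1 - \<delta>) * card P)"
  proof -
    have "\<delta> \<le> (1 - 2 * \<delta>) * (1 - \<delta>)" 
    proof -
      have "(1 - 2 * \<delta>) * (1 - \<delta>) - \<delta> = (1 - 4 * \<delta>) + 2 * \<delta>\<^sup>2"
        by (simp add: algebra_simps power2_eq_square)
      moreover have "0 \<le> 1 - 4 * \<delta>" using assms by simp
      ultimately show ?thesis by (smt (verit) zero_le_power2)
    qed
    thus ?thesis by (metis mult.assoc mult_right_mono of_nat_0_le_iff)
  qed
  also have "\<dots> \<le> (1 - 2 * \<delta>) * card R" using count assms by (intro mult_left_mono) auto
  finally have "0 \<le> ((1 - 2 * \<delta>) * card R - \<delta> * card P) * d" by simp
  also have "\<dots> = (\<Sum>v\<in>V. (if v \<in> R then (1 - 2 * \<delta>) * d else 0) - (if v \<in> P then \<delta> * d else 0))"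
    using PR fin by (simp add: sum_subtractf sum.If_cases Int_absorb1 algebra_simps)
  also have "\<dots> \<le> (\<Sum>v\<in>V. (real (card (B3 v)) - 1) - (1 + \<delta>) * d)"
  proof (intro sum_mono)
    fix v assume v: "v \<in> V"
    show "(if v \<in> R then (1 - 2 * \<delta>) * d else 0) - (if v \<in> P then \<delta> * d else 0)
        \<le> (real (card (B3 v)) - 1) - (1 + \<delta>) * d"
      using v disj B3_card_ge[OF v] by (auto simp: P_def R_def algebra_simps)
  qed
  finally show ?thesis by (simp add: sum_subtractf algebra_simps)
qed

end

section \<open>Graphs\<close>

lemma simple_graph_edgeD:
  assumes "simple_graph V E" "{x, y} \<in> E"
  shows "x \<in> V" "y \<in> V" "x \<noteq> y"
  using assms by (auto simp: simple_graph_def)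

lemma simple_graph_finite:
  assumes "finite V" "simple_graph V E"
  shows "finite E"
  using assms by (intro finite_subset[of E "Pow V"]) (auto simp: simple_graph_def)

lemma degree_eq_card_neighbours:
  assumes "simple_graph V E"
  shows "degree E v = card {y. {v, y} \<in> E}"
proof -
  have "bij_betw (\<lambda>y. {v, y}) {y. {v, y} \<in> E} {e \<in> E. v \<in> e}"
  proof (rule bij_betwI')
    fix e assume e: "e \<in> {e \<in> E. v \<in> e}"
    hence "card e = 2" using assms by (auto simp: simple_graph_def)
    then obtain a b where "e = {a, b}" by (auto simp: card_2_iff)
    thus "\<exists>y\<in>{y. {v, y} \<in> E}. e = {v, y}" using e by (auto simp: insert_commute)
  qed (auto simp: doubleton_eq_iff)
  thus ?thesis unfolding degree_def by (metis bij_betw_same_card)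
qed

lemma sum_degree:
  assumes "finite V" "simple_graph V E"
  shows "(\<Sum>v\<in>V. degree E v) = 2 * card E"
proof -
  have E: "finite E" using simple_graph_finite assms .
  have "(\<Sum>v\<in>V. degree E v) = (\<Sum>v\<in>V. \<Sum>e\<in>E. if v \<in> e then 1 else 0)"
    using E by (simp add: degree_def sum.If_cases Int_def)
  also have "\<dots> = (\<Sum>e\<in>E. \<Sum>v\<in>V. if v \<in> e then 1 else 0)" by (rule sum.swap)
  also have "\<dots> = (\<Sum>e\<in>E. 2)"
  proof (intro sum.cong refl)
    fix e assume "e \<in> E"
    hence "e \<subseteq> V" "card e = 2" using assms by (auto simp: simple_graph_def)
    thus "(\<Sum>v\<in>V. if v \<in> e then 1 else 0) = (2::nat)"
      using assms by (simp add: sum.If_cases Int_absorb1)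
  qed
  finally show ?thesis by simp
qed

lemma simple_graph_sumgraph: "simple_graph V (sumgraph_edges h V E)"
  by (auto simp: simple_graph_def sumgraph_edges_def)

text \<open>Containing the vertex itself allows a step to stand still, so that iterated
  neighbourhoods are balls.\<close>

definition closed_nbhd :: "'a set set \<Rightarrow> 'a \<Rightarrow> 'a set" where
  "closed_nbhd E x = insert x {y. {x, y} \<in> E}"

lemma path_stays_in_closed_set:
  assumes "successively (\<lambda>x y. {x, y} \<in> E) p" "p \<noteq> []" "hd p \<in> S"
    and "\<And>x. x \<in> S \<Longrightarrow> closed_nbhd E x \<subseteq> S"
  shows "last p \<in> S"
  using assms(1-3)
proof (induction p rule: induct_list012)
  case (3 x y zs)
  have "y \<in> S" using 3(3,5) assms(4)[of x] by (auto simp: closed_nbhd_def)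
  thus ?case using 3 by simp
qed auto

lemma regular_nbhds_closed_nbhd:
  assumes "finite V" "simple_graph V E" "connected_graph V E" "\<And>v. v \<in> V \<Longrightarrow> degree E v = d"
  shows "regular_nbhds V (closed_nbhd E) d"
proof
  show "finite V" by fact
  show "closed_nbhd E x \<subseteq> V" if "x \<in> V" for x
    using that simple_graph_edgeD[OF assms(2)] by (auto simp: closed_nbhd_def)
  show "x \<in> closed_nbhd E x" for x by (simp add: closed_nbhd_def)
  show "x \<in> closed_nbhd E y" if "y \<in> closed_nbhd E x" for x y
    using that by (auto simp: closed_nbhd_def insert_commute)
  show "card (closed_nbhd E x) = d + 1" if "x \<in> V" for x
  proof -
    have "finite {y. {x, y} \<in> E}"
      using simple_graph_edgeD[OF assms(2)] by (intro finite_subset[OF _ assms(1)]) auto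
    moreover have "x \<notin> {y. {x, y} \<in> E}" using simple_graph_edgeD(3)[OF assms(2)] by blast
    ultimately show ?thesis
      using assms(4)[OF that] degree_eq_card_neighbours[OF assms(2)] by (simp add: closed_nbhd_def)
  qed
  \<comment> \<open>A path starting in a set closed under neighbourhoods never leaves it, so
    connectedness rules out proper nonempty closed sets.\<close>
  show "S = V" if S: "S \<subseteq> V" "S \<noteq> {}" "\<And>x. x \<in> S \<Longrightarrow> closed_nbhd E x \<subseteq> S" for S
  proof
    obtain u where u: "u \<in> S" using S by blast
    show "V \<subseteq> S"
    proof
      fix v assume "v \<in> V"
      then obtain p where "joined_by_path V E u p v"
        using u S assms(3) unfolding connected_graph_def by blast
      thus "v \<in> S" using path_stays_in_closed_set[of E p S] S u by (auto simp: joined_by_path_def)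
    qed
  qed fact
qed

text \<open>A three-step walk may pause or revisit vertices, whereas \<open>joined_by_path\<close>
  wants distinct ones; the walk is shortened to a path with one, two or three edges.\<close>

lemma sumgraph_edges_3_I:
  assumes G: "simple_graph V E" and "x \<in> V" "x \<noteq> y"
    and "a \<in> closed_nbhd E x" "b \<in> closed_nbhd E a" "y \<in> closed_nbhd E b"
  shows "{x, y} \<in> sumgraph_edges 3 V E"
proof -
  note ed = simple_graph_edgeD[OF G]
  have I: "{x, y} \<in> sumgraph_edges 3 V E"
    if "joined_by_path V E x p y" "length p \<le> 4" for p
  proof -
    have "y \<in> V" using that unfolding joined_by_path_def by (metis last_in_set subsetD)
    thus ?thesis using assms(2,3) that unfolding sumgraph_edges_def by fastforce
  qed
  have 1: ?thesis if "{x, y} \<in> E"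
    using I[of "[x, y]"] that ed[OF that] by (simp add: joined_by_path_def)
  have 2: ?thesis if "{x, c} \<in> E" "{c, y} \<in> E" for c
    using I[of "[x, c, y]"] that ed[OF that(1)] ed[OF that(2)] assms(3)
    by (simp add: joined_by_path_def)
  \<comment> \<open>In the excluded cases \<open>b = x\<close> and \<open>a = y\<close> the walk
    contains the edge \<open>{x, y}\<close>, which case \<open>1\<close> handles.\<close>
  have 3: ?thesis if h: "{x, a} \<in> E" "{a, b} \<in> E" "{b, y} \<in> E" "b \<noteq> x" "a \<noteq> y"
    using I[of "[x, a, b, y]"] h ed[OF h(1)] ed[OF h(2)] ed[OF h(3)] assms(3)
    by (simp add: joined_by_path_def)
  show ?thesis using assms(3-) 1 2 3 by (auto simp: closed_nbhd_def)
qed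

lemma card_sumgraph_edges_3_ge:
  fixes \<delta> :: real
  assumes "finite V" and G: "simple_graph V E" and "connected_graph V E" "regular_graph V E"
    and "0 \<le> \<delta>" "\<delta> \<le> 1 / 4"
  shows "min (real (card V choose 2)) ((1 + \<delta>) * real (card E)) \<le> real (card (sumgraph_edges 3 V E))"
proof -
  obtain d where d: "\<And>v. v \<in> V \<Longrightarrow> degree E v = d"
    using assms(4) unfolding regular_graph_def by blast
  interpret regular_nbhds V "closed_nbhd E" d using regular_nbhds_closed_nbhd assms d by blast
  let ?S = "sumgraph_edges 3 V E"
  have SG: "simple_graph V ?S" by (rule simple_graph_sumgraph)
  have edge: "{x, y} \<in> ?S" if "x \<in> V" "y \<in> B3 x" "x \<noteq> y" for x y
    using that sumgraph_edges_3_I[OF G] by (auto simp: B2_def B3_def)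
  show ?thesis
  proof (cases "\<forall>x\<in>V. B3 x = V")
    case True
    have "{e. e \<subseteq> V \<and> card e = 2} \<subseteq> ?S"
    proof
      fix e assume "e \<in> {e. e \<subseteq> V \<and> card e = 2}"
      then obtain x y where "e = {x, y}" "x \<noteq> y" "x \<in> V" "y \<in> V" by (auto simp: card_2_iff)
      thus "e \<in> ?S" using edge True by auto
    qed
    hence "card V choose 2 \<le> card ?S"
      using n_subsets[OF assms(1), of 2] card_mono[OF simple_graph_finite[OF assms(1) SG]] by metis
    thus ?thesis by simp
  next
    case False
    have "(1 + \<delta>) * (2 * real (card E)) = (1 + \<delta>) * d * card V"
      
    proof -
      have "2 * card E = d * card V" using sum_degree[OF assms(1) G] d by (simp add: mult.commute)
      hence "2 * real (card E) = real d * real (card V)" by (metis of_nat_mult of_nat_numeral)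
      thus ?thesis by simp
    qed
    also have "\<dots> \<le> (\<Sum>v\<in>V. real (card (B3 v)) - 1)"
      using sum_card_B3_ge assms False by blast
    \<comment> \<open>All of \<open>B3 v\<close> except \<open>v\<close> itself is adjacent to
      \<open>v\<close> in the cube, which explains the \<open>- 1\<close>; the degree sum then
      counts each edge of the cube twice.\<close>
    also have "\<dots> \<le> (\<Sum>v\<in>V. real (degree ?S v))"
    proof (intro sum_mono)
      fix v assume v: "v \<in> V"
      have "B3 v - {v} \<subseteq> {y. {v, y} \<in> ?S}" using edge v by auto
      moreover have "finite {y. {v, y} \<in> ?S}"
        using simple_graph_edgeD[OF SG] by (intro finite_subset[OF _ assms(1)]) auto
      ultimately have "card (B3 v - {v}) \<le> degree ?S v"
        unfolding degree_eq_card_neighbours[OF SG] by (intro card_mono)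
      moreover have "card (B3 v) \<le> card (B3 v - {v}) + 1"
        by (simp add: card_Diff_singleton_if del: Suc_pred) linarith
      ultimately show "real (card (B3 v)) - 1 \<le> real (degree ?S v)" by linarith
    qed
    also have "\<dots> = 2 * real (card ?S)"
      using sum_degree[OF assms(1) SG] by (simp flip: of_nat_sum)
    finally show ?thesis by linarith
  qed
qed

theorem theorem1p5:
  "(\<exists>!x. is_eps_root x) \<and> \<bar>eps - 0.087\<bar> < 0.0005 \<and>
   (\<forall>(V :: 'a set) E n.
      finite V \<and> card V = n \<and> simple_graph V E \<and> connected_graph V E \<and> regular_graph V E \<longrightarrow>
      real (card (sumgraph_edges 3 V E))
        \<ge> min (real (n choose 2)) ((1 + eps) * real (card E))) \<and>
   (\<exists>\<epsilon>::real. \<epsilon> > 0 \<and> (\<forall>(V :: 'a set) E n.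
      finite V \<and> card V = n \<and> simple_graph V E \<and> connected_graph V E \<and> regular_graph V E \<longrightarrow>
      real (card (sumgraph_edges 3 V E))
        \<ge> min (real (n choose 2)) ((1 + \<epsilon>) * real (card E))))"
proof (intro conjI)
  show "\<exists>!x. is_eps_root x" using eps_props(1) is_eps_root_unique by blast
  show "\<bar>eps - 0.087\<bar> < 0.0005" using eps_props(2,3) by (auto simp: abs_if)
  show main: "\<forall>(V :: 'a set) E n.
      finite V \<and> card V = n \<and> simple_graph V E \<and> connected_graph V E \<and> regular_graph V E \<longrightarrow>
      real (card (sumgraph_edges 3 V E))
        \<ge> min (real (n choose 2)) ((1 + eps) * real (card E))"
    \<comment> \<open>The numerical bounds place \<open>eps\<close> between 0 and 1/4, the range
      covered by the general estimate.\<close>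
    using eps_props by (auto intro!: card_sumgraph_edges_3_ge)
  show "\<exists>\<epsilon>::real. \<epsilon> > 0 \<and> (\<forall>(V :: 'a set) E n.
      finite V \<and> card V = n \<and> simple_graph V E \<and> connected_graph V E \<and> regular_graph V E \<longrightarrow>
      real (card (sumgraph_edges 3 V E))
        \<ge> min (real (n choose 2)) ((1 + \<epsilon>) * real (card E)))"
    by (rule exI[of _ eps], rule conjI[OF _ main]) (use eps_props in simp)
qed

end
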